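(* Let $1<p_i<\infty$ for $i\in\mathbb N$, and $\frac1p=\sum_{i=1}^{\infty}\frac1{p_i}$. Let $v$ and $\omega_i$ ($i\in\mathbb N$) be weights on $\mathbb R^n$, satisfying the standing assumptions listed in the context. Then the following statements are equivalent: (1) There exists a positive constant $C$ such that $$\Big(\frac{1}{|B|}\int_B v(x)\,dx\Big)^{\frac1p}\prod_{i=1}^{\infty}\Big(\frac{1}{|B|}\int_B\omega_i^{-\frac{1}{p_i-1}}(y_i)\,dy_i\Big)^{\frac{1}{p_i'}}\le C,\quad\forall B\in\mathcal D.$$ (2) There exists a positive constant $C$ such that $$v(B)^{\frac1p}\prod_{i=1}^{\infty}\Big(\frac{1}{|B|}\int_B f_i(y_i)\,dy_i\Big)\le C\prod_{i=1}^{\infty}\|f_i\chi_B\|_{L^{p_i}(\omega_i)},\quad\forall \overrightarrow f\in\prod_{i=1}^{\infty}L^{p_i}(\omega_i),\ B\in\mathcal D.$$ (3) There exists a positive constant $C$ such that $$\lambda\, v(\{\mathfrak M_d(\overrightarrow f)\ge\lambda\})^{\frac1p}\le C\prod_{i=1}^{\infty}\|f_i\|_{L^{p_i}(\omega_i)},\quad\forall \overrightarrow f\in\prod_{i=1}^{\infty}L^{p_i}(\omega_i),\ \lambda>0.$$ (4) There exists a positive constant $C$ such that $$\lambda\, v(\{\mathfrak M_d(\overrightarrow f)>\lambda\})^{\frac1p}\le C\prod_{i=1}^{\infty}\|f_i\|_{L^{p_i}(\omega_i)},\quad\forall \overrightarrow f\in\prod_{i=1}^{\infty}L^{p_i}(\omega_i),\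 \lambda>0.$$ Moreover, denote the smallest constants $C$ in (1), (2), (3) and (4) by $[v,\overrightarrow\omega]_{A_{\overrightarrow p}}$, $[v,\overrightarrow\omega]'_{A_{\overrightarrow p}}$, $\|\mathfrak M_d\|'$ and $\|\mathfrak M_d\|$, respectively. Then $$[v,\overrightarrow\omega]_{A_{\overrightarrow p}}=[v,\overrightarrow\omega]'_{A_{\overrightarrow p}}=\|\mathfrak M_d\|'=\|\mathfrak M_d\|.$$
   Context: A weight is a positive locally integrable function on $\mathbb R^n$; for a weight $v$ and measurable $E$, $v(E)=\int_E v\,dx$. $|B|$ is Lebesgue measure and $\frac1{p_i}+\frac1{p_i'}=1$. An infinite product $\prod_{i=1}^\infty c_i$ denotes $\lim_{n\to\infty}\prod_{i=1}^n c_i$; it converges if this limit exists (the limit may be $0$), and for nonnegative $c_i$ writing $\prod c_i<\infty$ means that it converges to a finite limit. Dyadic cubes: for $k\in\mathbb Z$, $\mathcal D_k$ is the family of half-open cubes $2^{-k}(m+[0,1)^n)$, $m\in\mathbb Z^n$, and $\mathcal D=\bigcup_{k\in\mathbb Z}\mathcal D_k$. For locally integrable $f$, $E_k(f)(x)=\sum_{B\in\mathcal D_k}\big(\frac1{|B|}\int_B f(y)\,dy\big)\chi_B(x)$. Generalized dyadic maximal operator: for $\overrightarrow f=(f_1,f_2,\dots)$, $$\mathfrak M_d(\overrightarrow f)(x)=\sup_{x\in B\in\mathcal D}\prod_{i=1}^{\infty}\frac{1}{|B|}\int_B|f_i(y_i)|\,dy_i .$$ $\overrightarrow f\in\prod_{i=1}^\infty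 L^{p_i}(\omega_i)$ means that the $f_i$ are nonnegative measurable functions on $\mathbb R^n$ with $f_i\in L^{p_i}(\omega_i)$ and $\prod_{i=1}^\infty\|f_i\|_{L^{p_i}(\omega_i)}<\infty$, where $\|f\|_{L^{q}(\omega)}=(\int_{\mathbb R^n}|f|^q\omega\,dx)^{1/q}$. Standing assumptions, with $\sigma_i=\omega_i^{-\frac1{p_i-1}}=\omega_i^{1-p_i'}$: the sum $\frac1p=\sum_i\frac1{p_i}$ is finite (so $0<p<\infty$); $\prod_{i=1}^\infty E_k(\sigma_i)^{1/p_i'}<\infty$ for all $k\in\mathbb Z$; $\prod_{i=1}^\infty\sigma_i^{1/p_i}>0$; and for every $B\in\mathcal D$, $(\sigma_1\chi_B,\sigma_2\chi_B,\dots)\in\prod_{i=1}^\infty L^{p_i}(\omega_i)$. (Under these, $\mathfrak M_d(\overrightarrow f)$ is well defined for all $\overrightarrow f\in\prod L^{p_i}(\omega_i)$.) *)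

theory Defs
  imports "HOL-Analysis.Analysis"
begin

text \<open>Every integrand below is nonnegative (almost everywhere), so averages, norms, weighted
  measures and infinite products take values in \<^typ>\<open>ennreal\<close>.  Null sets and measurability
  refer to Lebesgue (not just Borel) measurable functions and sets.\<close>

text \<open>Only used with \<open>a > 0\<close>, whence \<open>\<infinity>\<close> to the power \<open>a\<close> is \<open>\<infinity>\<close>.\<close>

definition epowr :: "ennreal \<Rightarrow> real \<Rightarrow> ennreal" where
  "epowr x a = (if x = \<infinity> then \<infinity> else ennreal (enn2real x powr a))"

text \<open>Infinite products are plain limits of partial products in \<open>[0,\<infinity>]\<close>.  The library's
  \<^const>\<open>convergent_prod\<close> and \<^const>\<open>prodinf\<close> do not fit: they do not count
  divergence to \<open>0\<close> as convergence.\<close>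

definition iprod_converges :: "(nat \<Rightarrow> ennreal) \<Rightarrow> bool" where
  "iprod_converges c \<longleftrightarrow> convergent (\<lambda>n. \<Prod>i<n. c i)"

definition iprod :: "(nat \<Rightarrow> ennreal) \<Rightarrow> ennreal" where
  "iprod c = lim (\<lambda>n. \<Prod>i<n. c i)"

definition iprod_finite :: "(nat \<Rightarrow> ennreal) \<Rightarrow> bool" where
  "iprod_finite c \<longleftrightarrow> iprod_converges c \<and> iprod c < \<infinity>"

definition dyadic_cube :: "int \<Rightarrow> int ^ 'n \<Rightarrow> (real ^ 'n) set" where
  "dyadic_cube k m = {x. \<forall>j. 2 powi (-k) * of_int (m $ j) \<le> x $ j \<and>
                             x $ j < 2 powi (-k) * (of_int (m $ j) + 1)}"

definition dyadic_level :: "int \<Rightarrow> (real ^ 'n) set set" where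
  "dyadic_level k = range (dyadic_cube k)"

definition dyadic :: "(real ^ 'n) set set" where
  "dyadic = (\<Union>k. dyadic_level k)"

definition weight :: "(real ^ 'n \<Rightarrow> real) \<Rightarrow> bool" where
  "weight v \<longleftrightarrow> v \<in> borel_measurable lebesgue \<and> (AE x in lebesgue. 0 < v x) \<and>
     (\<forall>K. compact K \<longrightarrow> v absolutely_integrable_on K)"

definition wmeasure :: "(real ^ 'n \<Rightarrow> real) \<Rightarrow> (real ^ 'n) set \<Rightarrow> ennreal" where
  "wmeasure v E = (\<integral>\<^sup>+x\<in>E. ennreal (v x) \<partial>lebesgue)"

definition average :: "(real ^ 'n \<Rightarrow> real) \<Rightarrow> (real ^ 'n) set \<Rightarrow> ennreal" where
  "average f B = (\<integral>\<^sup>+y\<in>B. ennreal (f y) \<partial>lebesgue) / emeasure lebesgue B"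

definition cond_exp_dyadic :: "int \<Rightarrow> (real ^ 'n \<Rightarrow> real) \<Rightarrow> real ^ 'n \<Rightarrow> ennreal" where
  "cond_exp_dyadic k f x = (\<Sum>\<^sub>\<infinity>B\<in>dyadic_level k. average f B * indicator B x)"

definition wnorm :: "real \<Rightarrow> (real ^ 'n \<Rightarrow> real) \<Rightarrow> (real ^ 'n \<Rightarrow> real) \<Rightarrow> ennreal" where
  "wnorm q w f = epowr (\<integral>\<^sup>+x. ennreal (\<bar>f x\<bar> powr q * w x) \<partial>lebesgue) (1 / q)"

definition product_space ::
    "(nat \<Rightarrow> real) \<Rightarrow> (nat \<Rightarrow> real ^ 'n \<Rightarrow> real) \<Rightarrow> (nat \<Rightarrow> real ^ 'n \<Rightarrow> real) set" where
  "product_space ps w = {f.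
     (\<forall>i. f i \<in> borel_measurable lebesgue \<and> (\<forall>x. 0 \<le> f i x) \<and> wnorm (ps i) (w i) (f i) < \<infinity>) \<and>
     iprod_finite (\<lambda>i. wnorm (ps i) (w i) (f i))}"

definition dyadic_maximal :: "(nat \<Rightarrow> real ^ 'n \<Rightarrow> real) \<Rightarrow> real ^ 'n \<Rightarrow> ennreal" where
  "dyadic_maximal f x =
     (SUP B\<in>{B \<in> dyadic. x \<in> B}. iprod (\<lambda>i. average (\<lambda>y. \<bar>f i y\<bar>) B))"

definition conj_exponent :: "real \<Rightarrow> real" where
  "conj_exponent q = q / (q - 1)"

definition dual_weight :: "real \<Rightarrow> (real ^ 'n \<Rightarrow> real) \<Rightarrow> real ^ 'n \<Rightarrow> real" where
  "dual_weight q w x = w x powr (- 1 / (q - 1))"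

definition standing_assumptions ::
    "(nat \<Rightarrow> real) \<Rightarrow> (nat \<Rightarrow> real ^ 'n \<Rightarrow> real) \<Rightarrow> bool" where
  "standing_assumptions ps w \<longleftrightarrow>
     (\<forall>k x. iprod_finite
        (\<lambda>i. epowr (cond_exp_dyadic k (dual_weight (ps i) (w i)) x) (1 / conj_exponent (ps i)))) \<and>
     (AE x in lebesgue.
        iprod_converges (\<lambda>i. ennreal (dual_weight (ps i) (w i) x powr (1 / ps i))) \<and>
        0 < iprod (\<lambda>i. ennreal (dual_weight (ps i) (w i) x powr (1 / ps i)))) \<and>
     (\<forall>B\<in>dyadic. (\<lambda>i x. dual_weight (ps i) (w i) x * indicator B x) \<in> product_space ps w)"

definition Ap_bound :: "real \<Rightarrow> (nat \<Rightarrow> real) \<Rightarrow> (real ^ 'n \<Rightarrow> real) \<Rightarrow>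
    (nat \<Rightarrow> real ^ 'n \<Rightarrow> real) \<Rightarrow> real \<Rightarrow> bool" where
  "Ap_bound p ps v w C \<longleftrightarrow> (\<forall>B\<in>dyadic.
     epowr (average v B) (1 / p) *
       iprod (\<lambda>i. epowr (average (\<lambda>y. w i y powr (- 1 / (ps i - 1))) B) (1 / conj_exponent (ps i)))
     \<le> ennreal C)"

definition averaging_bound :: "real \<Rightarrow> (nat \<Rightarrow> real) \<Rightarrow> (real ^ 'n \<Rightarrow> real) \<Rightarrow>
    (nat \<Rightarrow> real ^ 'n \<Rightarrow> real) \<Rightarrow> real \<Rightarrow> bool" where
  "averaging_bound p ps v w C \<longleftrightarrow> (\<forall>f\<in>product_space ps w. \<forall>B\<in>dyadic.
     epowr (wmeasure v B) (1 / p) * iprod (\<lambda>i. average (f i) B)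
     \<le> ennreal C * iprod (\<lambda>i. wnorm (ps i) (w i) (\<lambda>x. f i x * indicator B x)))"

definition weak_type_ge_bound :: "real \<Rightarrow> (nat \<Rightarrow> real) \<Rightarrow> (real ^ 'n \<Rightarrow> real) \<Rightarrow>
    (nat \<Rightarrow> real ^ 'n \<Rightarrow> real) \<Rightarrow> real \<Rightarrow> bool" where
  "weak_type_ge_bound p ps v w C \<longleftrightarrow> (\<forall>f\<in>product_space ps w. \<forall>l>0.
     ennreal l * epowr (wmeasure v {x. dyadic_maximal f x \<ge> ennreal l}) (1 / p)
     \<le> ennreal C * iprod (\<lambda>i. wnorm (ps i) (w i) (f i)))"

definition weak_type_gt_bound :: "real \<Rightarrow> (nat \<Rightarrow> real) \<Rightarrow> (real ^ 'n \<Rightarrow> real) \<Rightarrow>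
    (nat \<Rightarrow> real ^ 'n \<Rightarrow> real) \<Rightarrow> real \<Rightarrow> bool" where
  "weak_type_gt_bound p ps v w C \<longleftrightarrow> (\<forall>f\<in>product_space ps w. \<forall>l>0.
     ennreal l * epowr (wmeasure v {x. dyadic_maximal f x > ennreal l}) (1 / p)
     \<le> ennreal C * iprod (\<lambda>i. wnorm (ps i) (w i) (f i)))"

text \<open>The smallest admissible constant, with value \<open>\<infinity>\<close> if there is none.  The value \<open>C = 0\<close>
  is allowed because the left-hand side of \<^const>\<open>Ap_bound\<close> may vanish for every cube: the
  infinite product can converge to \<open>0\<close>, and then no positive constant is smallest.\<close>

definition smallest_const :: "(real \<Rightarrow> bool) \<Rightarrow> ennreal" where
  "smallest_const P = Inf {ennreal C | C. 0 \<le> C \<and> P C}"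

end

theory Submission
  imports Defs
begin

text \<open>All four bounds are equivalent with the same constant \<open>C\<close>, so the smallest constants agree.
  Hoelder's inequality bounds each average of \<open>f\<^sub>i\<close> by an average of the dual weight times a
  weighted norm, which gives (2) from (1); testing (2) on \<open>\<sigma>\<^sub>i \<chi>\<^sub>B\<close> gives (1) back,
  since \<open>\<Prod>\<^sub>i \<sigma>\<^sub>i(B)\<^bsup>1/p\<^sub>i\<^esup>\<close> is finite by assumption and positive by Hoelder's inequality
  for infinitely many functions.  For (3), \<open>{x. dyadic_maximal f x > l}\<close> is a union of dyadic cubes
  on which (2) can be applied; disjoint cubes are added up with the infinite Hoelder inequality for
  sums.  Finally (2) is (4) for the functions \<open>f\<^sub>i \<chi>\<^sub>B\<close>.\<close>

section \<open>Powers and infinite products in \<open>[0,\<infinity>]\<close>\<close>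

lemma epowr_ennreal [simp]: "0 \<le> x \<Longrightarrow> epowr (ennreal x) a = ennreal (x powr a)"
  by (simp add: epowr_def)

lemma epowr_top [simp]: "epowr top a = top"
  by (simp add: epowr_def)

lemma epowr_one [simp]: "epowr 1 a = 1"
  by (simp add: epowr_def)

lemma epowr_zero [simp]: "epowr 0 a = 0"
  by (simp add: epowr_def)

lemma epowr_exponent_one [simp]: "epowr x 1 = x"
  by (cases x) auto

lemma epowr_eq_0_iff [simp]: "epowr x a = 0 \<longleftrightarrow> x = 0"
  by (cases x) (auto simp: ennreal_eq_0_iff)

lemma epowr_eq_top_iff [simp]: "epowr x a = top \<longleftrightarrow> x = top"
  by (cases x) auto

lemma epowr_less_top_iff [simp]: "epowr x a < top \<longleftrightarrow> x < top"
  by (cases x) auto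

text \<open>Zero and infinity are fixed by every power, since \<open>0 powr a = 0\<close> even for
  \<open>a \<le> 0\<close>, and \<open>0 * top = 0\<close> on both sides; hence the exponent needs
  no sign condition.\<close>

lemma epowr_mult: "epowr (x * y) a = epowr x a * epowr y a"
proof (cases "x = top \<or> y = top")
  case True
  then show ?thesis by (auto simp: ennreal_top_mult ennreal_mult_top)
next
  case False
  then show ?thesis
    by (cases x; cases y) (auto simp: ennreal_mult'[symmetric] powr_mult)
qed

lemma epowr_prod: "epowr (\<Prod>i\<in>I. f i) a = (\<Prod>i\<in>I. epowr (f i) a)"
  by (induction I rule: infinite_finite_induct) (auto simp: epowr_mult)

lemma epowr_add: "epowr x (a + b) = epowr x a * epowr x b"
  by (cases x) (auto simp: ennreal_mult'[symmetric] powr_add)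

lemma epowr_epowr: "epowr (epowr x a) b = epowr x (a * b)"
  by (cases x) (auto simp: powr_powr)

lemma epowr_mono: "0 \<le> a \<Longrightarrow> x \<le> y \<Longrightarrow> epowr x a \<le> epowr y a"
  by (cases x; cases y) (auto intro!: ennreal_leI powr_mono2 simp: top_unique)

lemma epowr_le_iff: "0 < a \<Longrightarrow> epowr x a \<le> epowr y a \<longleftrightarrow> x \<le> y"
  using epowr_mono[of a x y] epowr_mono[of "1 / a" "epowr x a" "epowr y a"]
  by (auto simp: epowr_epowr)

lemma measurable_epowr [measurable]: "(\<lambda>x. epowr x a) \<in> borel_measurable borel"
  unfolding epowr_def by measurable

text \<open>A finite limit makes the values eventually finite, so continuity of the real power
  applies. Positivity of \<open>a\<close> matters at \<open>L = 0\<close>, where a negative power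
  would blow up.\<close>

lemma tendsto_epowr:
  assumes "(f \<longlongrightarrow> L) F" "L < top" "0 < a"
  shows "((\<lambda>n. epowr (f n) a) \<longlongrightarrow> epowr L a) F"
proof -
  have ev: "eventually (\<lambda>n. f n < top) F"
    using assms(1,2) by (rule order_tendstoD)
  have "((\<lambda>n. enn2real (f n)) \<longlongrightarrow> enn2real L) F"
    using assms by (auto intro: tendsto_enn2real)
  then have "((\<lambda>n. ennreal (enn2real (f n) powr a)) \<longlongrightarrow> ennreal (enn2real L powr a)) F"
    using assms(3) by (intro tendsto_ennrealI tendsto_powr2) auto
  moreover have "ennreal (enn2real L powr a) = epowr L a"
    using assms(2) by (auto simp: epowr_def)
  moreover have "eventually (\<lambda>n. ennreal (enn2real (f n) powr a) = epowr (f n) a) F"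
    using ev by eventually_elim (auto simp: epowr_def)
  ultimately show ?thesis by (simp add: tendsto_cong)
qed

lemma tendsto_epowr_exponent_0:
  assumes "(b \<longlongrightarrow> 0) F" "x \<noteq> 0" "x < top"
  shows "((\<lambda>n. epowr x (b n)) \<longlongrightarrow> 1) F"
proof -
  have x: "enn2real x \<noteq> 0" using assms by (auto simp: enn2real_eq_0_iff)
  have "((\<lambda>n. ennreal (enn2real x powr b n)) \<longlongrightarrow> ennreal (enn2real x powr 0)) F"
    by (intro tendsto_ennrealI tendsto_powr assms tendsto_const x)
  then show ?thesis using assms x by (simp add: epowr_def less_top[symmetric])
qed

section \<open>Infinite products as limits of partial products\<close>

lemma iprod_LIMSEQ: "iprod_converges c \<Longrightarrow> (\<lambda>n. \<Prod>i<n. c i) \<longlonglongrightarrow> iprod c"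
  unfolding iprod_converges_def iprod_def by (rule convergent_LIMSEQ_iff[THEN iffD1])

lemma iprod_eqI: "(\<lambda>n. \<Prod>i<n. c i) \<longlonglongrightarrow> L \<Longrightarrow> iprod_converges c \<and> iprod c = L"
  unfolding iprod_converges_def iprod_def by (auto simp: convergent_def dest: limI)

lemma iprod_mult:
  assumes "iprod_finite c" "iprod_finite d"
  shows "iprod_finite (\<lambda>i. c i * d i)" "iprod (\<lambda>i. c i * d i) = iprod c * iprod d"
proof -
  have "(\<lambda>n. (\<Prod>i<n. c i) * (\<Prod>i<n. d i)) \<longlonglongrightarrow> iprod c * iprod d"
    using assms by (intro tendsto_mult_ennreal iprod_LIMSEQ) (auto simp: iprod_finite_def)
  then have "(\<lambda>n. \<Prod>i<n. c i * d i) \<longlonglongrightarrow> iprod c * iprod d"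
    by (simp add: prod.distrib)
  from iprod_eqI[OF this] assms
  show "iprod_finite (\<lambda>i. c i * d i)" "iprod (\<lambda>i. c i * d i) = iprod c * iprod d"
    by (auto simp: iprod_finite_def ennreal_mult_less_top)
qed

lemma iprod_epowr:
  assumes "iprod_finite c" "0 < a"
  shows "iprod_finite (\<lambda>i. epowr (c i) a)" "iprod (\<lambda>i. epowr (c i) a) = epowr (iprod c) a"
proof -
  have "(\<lambda>n. \<Prod>i<n. epowr (c i) a) \<longlonglongrightarrow> epowr (iprod c) a"
    using assms tendsto_epowr[OF iprod_LIMSEQ, of c a] by (auto simp: iprod_finite_def epowr_prod)
  from iprod_eqI[OF this] assms
  show "iprod_finite (\<lambda>i. epowr (c i) a)" "iprod (\<lambda>i. epowr (c i) a) = epowr (iprod c) a"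
    by (auto simp: iprod_finite_def)
qed

text \<open>The partial products decrease from the empty product 1, so they converge to their
  infimum.\<close>

lemma iprod_finite_le_1:
  assumes "\<And>i. c i \<le> 1"
  shows "iprod_finite c"
proof -
  have dec: "decseq (\<lambda>n. \<Prod>i<n. c i)"
    by (rule decseq_SucI) (use assms mult_left_mono[of "c _" 1] in auto)
  note L = LIMSEQ_INF[OF dec]
  have "(INF n. \<Prod>i<n. c i) \<le> (\<Prod>i<0. c i)" by (rule INF_lower) simp
  then show ?thesis
    using iprod_eqI[OF L] by (auto simp: iprod_finite_def intro: le_less_trans)
qed

lemma iprod_mono:
  assumes "iprod_converges c" "iprod_converges d" "\<And>i. c i \<le> d i"
  shows "iprod c \<le> iprod d"
  by (rule LIMSEQ_le[OF iprod_LIMSEQ iprod_LIMSEQ])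
     (use assms in \<open>auto intro!: prod_mono_ennreal\<close>)

text \<open>The ratios lie in \<open>[0,1]\<close>, so their partial products decrease; in particular no lower bound
  on the factors is needed.\<close>

lemma iprod_finite_dominated:
  assumes "iprod_finite d" "\<And>i. d i < top" "\<And>i. c i \<le> d i"
  shows "iprod_finite c"
proof -
  \<comment> \<open>If \<open>d i = 0\<close>, domination forces \<open>c i = 0\<close>, so the
    identity survives division by zero; finiteness of \<open>d i\<close> is needed because dividing
    by \<open>top\<close> gives 0.\<close>
  have eq: "c i = c i / d i * d i" for i
    using assms(2,3)[of i]
    by (cases "d i = 0") (auto simp: ennreal_divide_times ennreal_times_divide[symmetric] mult_divide_eq_ennreal)
  have le: "c i / d i \<le> 1" for i
    using assms(2,3)[of i] by (cases "d i = 0") (auto intro!: divide_le_posI_ennreal simp: zero_less_iff_neq_zero)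
  have "iprod_finite (\<lambda>i. c i / d i * d i)"
    using iprod_mult(1)[OF iprod_finite_le_1 assms(1), of "\<lambda>i. c i / d i"] le by auto
  then show ?thesis by (simp add: eq[symmetric])
qed

section \<open>Hoelder inequalities\<close>

text \<open>Jensen's inequality for \<open>exp\<close> at the points \<open>ln (x i)\<close>; a
  vanishing \<open>x i\<close> has no logarithm, but it makes the left-hand side 0.\<close>

lemma weighted_arith_geom_mean:
  fixes x a :: "'a \<Rightarrow> real"
  assumes "finite I" "\<And>i. i \<in> I \<Longrightarrow> 0 \<le> a i" "\<And>i. i \<in> I \<Longrightarrow> 0 \<le> x i" "sum a I = 1"
  shows "(\<Prod>i\<in>I. x i powr a i) \<le> (\<Sum>i\<in>I. a i * x i)"
proof (cases "\<exists>i\<in>I. x i = 0")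
  case True
  then have "(\<Prod>i\<in>I. x i powr a i) = 0" using assms(1) by (auto simp: prod_zero_iff)
  then show ?thesis using assms by (simp add: sum_nonneg del: prod_zero_iff)
next
  case False
  then have pos: "x i \<noteq> 0" "0 < x i" if "i \<in> I" for i using assms(3)[OF that] that by force+
  have "(\<Prod>i\<in>I. x i powr a i) = exp (\<Sum>i\<in>I. a i *\<^sub>R ln (x i))"
    using pos by (auto simp: exp_sum[OF assms(1)] powr_def intro!: prod.cong)
  also have "\<dots> \<le> (\<Sum>i\<in>I. a i * exp (ln (x i)))"
    by (rule convex_on_sum[OF assms(1) _ exp_convex assms(4)]) (use assms in auto)
  also have "\<dots> = (\<Sum>i\<in>I. a i * x i)" using pos by (intro sum.cong) auto
  finally show ?thesis .
qed

text \<open>The weights are strictly positive here: with weight 0, an infinite \<open>x i\<close>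
  would contribute 0 on the right but \<open>epowr top 0 = top\<close> on the left.\<close>

lemma weighted_arith_geom_mean_ennreal:
  fixes x :: "'a \<Rightarrow> ennreal"
  assumes "finite I" "\<And>i. i \<in> I \<Longrightarrow> 0 < a i" "sum a I = 1"
  shows "(\<Prod>i\<in>I. epowr (x i) (a i)) \<le> (\<Sum>i\<in>I. ennreal (a i) * x i)"
proof (cases "\<exists>i\<in>I. x i = top")
  case True
  then have "(\<Sum>i\<in>I. ennreal (a i) * x i) = top"
    using assms by (force simp: ennreal_mult_eq_top_iff ennreal_eq_0_iff not_le)
  then show ?thesis by simp
next
  case False
  have "(\<Prod>i\<in>I. epowr (x i) (a i)) = (\<Prod>i\<in>I. ennreal (enn2real (x i) powr a i))"
    using False by (intro prod.cong) (auto simp: epowr_def)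
  also have "\<dots> = ennreal (\<Prod>i\<in>I. enn2real (x i) powr a i)"
    by (simp add: prod_ennreal)
  also have "\<dots> \<le> ennreal (\<Sum>i\<in>I. a i * enn2real (x i))"
    by (intro ennreal_leI weighted_arith_geom_mean) (use assms in \<open>auto intro: less_imp_le\<close>)
  also have "\<dots> = (\<Sum>i\<in>I. ennreal (a i * enn2real (x i)))"
    using assms by (subst sum_ennreal) (auto intro!: mult_nonneg_nonneg simp: less_imp_le)
  also have "\<dots> = (\<Sum>i\<in>I. ennreal (a i) * x i)"
    using False assms by (intro sum.cong) (auto simp: ennreal_mult less_imp_le less_top)
  finally show ?thesis .
qed

text \<open>Each function is divided by its integral; the weighted mean inequality is then applied
  pointwise and integrated.\<close>

lemma Holder_finite_prod:
  fixes F :: "'i \<Rightarrow> 'a \<Rightarrow> ennreal"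
  assumes "finite I" "\<And>i. i \<in> I \<Longrightarrow> 0 < a i" "sum a I = 1"
    and [measurable]: "\<And>i. i \<in> I \<Longrightarrow> F i \<in> borel_measurable M"
  shows "(\<integral>\<^sup>+x. (\<Prod>i\<in>I. epowr (F i x) (a i)) \<partial>M) \<le> (\<Prod>i\<in>I. epowr (\<integral>\<^sup>+x. F i x \<partial>M) (a i))"
proof -
  define N where "N i = (\<integral>\<^sup>+x. F i x \<partial>M)" for i
  \<comment> \<open>Normalisation needs all integrals in \<open>(0,\<infinity>)\<close>. A zero
    integral is treated before an infinite one, because \<open>0 * top = 0\<close> then makes the
    right-hand side 0.\<close>
  consider i where "i \<in> I" "N i = 0" | "\<And>i. i \<in> I \<Longrightarrow> N i \<noteq> 0" "\<exists>i\<in>I. N i = top"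
    | "\<And>i. i \<in> I \<Longrightarrow> N i \<noteq> 0" "\<And>i. i \<in> I \<Longrightarrow> N i < top"
    by (metis less_top)
  then show ?thesis
  proof cases
    case 1
    then have "AE x in M. F i x = 0"
      unfolding N_def by (subst (asm) nn_integral_0_iff_AE) auto
    then have "AE x in M. (\<Prod>i\<in>I. epowr (F i x) (a i)) = 0"
      by eventually_elim (use 1 assms(1) in \<open>auto simp: prod_zero_iff\<close>)
    then have "(\<integral>\<^sup>+x. (\<Prod>i\<in>I. epowr (F i x) (a i)) \<partial>M) = (\<integral>\<^sup>+x. 0 \<partial>M)"
      by (rule nn_integral_cong_AE)
    then show ?thesis by simp
  next
    case 2
    then have "(\<Prod>i\<in>I. epowr (N i) (a i)) = top"
      using assms(1) by (auto simp: ennreal_prod_eq_top)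
    then show ?thesis by (simp add: N_def)
  next
    case 3
    define P where "P = (\<Prod>i\<in>I. epowr (N i) (a i))"
    have eq: "(\<Prod>i\<in>I. epowr (F i x) (a i)) = P * (\<Prod>i\<in>I. epowr (F i x / N i) (a i))" for x
    proof -
      have "epowr (F i x) (a i) = epowr (N i) (a i) * epowr (F i x / N i) (a i)" if "i \<in> I" for i
        using 3[OF that]
        by (simp add: epowr_mult[symmetric] ennreal_times_divide mult.commute[of "N i"] mult_divide_eq_ennreal)
      then show ?thesis by (simp add: P_def prod.distrib cong: prod.cong)
    qed
    have "(\<integral>\<^sup>+x. (\<Prod>i\<in>I. epowr (F i x) (a i)) \<partial>M)
        \<le> (\<integral>\<^sup>+x. P * (\<Sum>i\<in>I. ennreal (a i) * (F i x / N i)) \<partial>M)"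
      unfolding eq by (intro nn_integral_mono mult_left_mono weighted_arith_geom_mean_ennreal assms) auto
    also have "\<dots> = P * (\<Sum>i\<in>I. ennreal (a i) * (N i / N i))"
      unfolding N_def
      by (subst nn_integral_cmult, measurable, subst nn_integral_sum)
         (auto simp: nn_integral_cmult nn_integral_divide intro!: sum.cong)
    also have "(\<Sum>i\<in>I. ennreal (a i) * (N i / N i)) = (\<Sum>i\<in>I. ennreal (a i))"
      using 3 by (intro sum.cong) auto
    also have "\<dots> = 1" using assms by (subst sum_ennreal) (auto simp: less_imp_le)
    finally show ?thesis by (simp add: P_def N_def)
  qed
qed

lemma Holder_two:
  fixes F G :: "'a \<Rightarrow> ennreal"
  assumes "0 < a" "0 < b" "a + b = 1" "F \<in> borel_measurable M" "G \<in> borel_measurable M"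
  shows "(\<integral>\<^sup>+x. epowr (F x) a * epowr (G x) b \<partial>M)
    \<le> epowr (\<integral>\<^sup>+x. F x \<partial>M) a * epowr (\<integral>\<^sup>+x. G x \<partial>M) b"
  using Holder_finite_prod[of UNIV "\<lambda>c. if c then a else b" "\<lambda>c. if c then F else G" M] assms
  by (simp add: UNIV_bool mult.commute add.commute)

text \<open>Finite Hoelder is applied to the first n functions and the constant 1, which absorbs the
  missing exponent. On a space of positive finite mass its factor tends to 1, and Fatou's lemma
  gives the limit. Only the bounds \<open>N\<close> must have a convergent product, so the left-hand
  side uses a liminf.\<close>

lemma Holder_iprod:
  fixes F :: "nat \<Rightarrow> 'a \<Rightarrow> ennreal"
  assumes M: "emeasure M (space M) \<noteq> 0" "emeasure M (space M) < top"
    and a: "\<And>i. 0 < a i" "a sums 1"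
    and [measurable]: "\<And>i. F i \<in> borel_measurable M"
    and N: "\<And>i. (\<integral>\<^sup>+x. F i x \<partial>M) \<le> N i" "iprod_finite (\<lambda>i. epowr (N i) (a i))"
  shows "(\<integral>\<^sup>+x. liminf (\<lambda>n. \<Prod>i<n. epowr (F i x) (a i)) \<partial>M) \<le> iprod (\<lambda>i. epowr (N i) (a i))"
proof -
  define b where "b n = 1 - (\<Sum>i<n. a i)" for n
  let ?m = "emeasure M (space M)"
  have b: "0 < b n" for n
    using sum_less_suminf[of a n] a by (simp add: b_def sums_iff)
  have "b \<longlonglongrightarrow> 1 - 1"
    unfolding b_def using a(2) by (intro tendsto_intros) (simp add: sums_def)
  then have b0: "b \<longlonglongrightarrow> 0" by simp
  have bound: "(\<integral>\<^sup>+x. (\<Prod>i<n. epowr (F i x) (a i)) \<partial>M) \<le> epowr ?m (b n) * (\<Prod>i<n. epowr (N i) (a i))" for n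
  proof -
    \<comment> \<open>The extra index \<open>n\<close> carries the constant function 1 with exponent
      \<open>b n\<close>, so that the exponents add up to 1.\<close>
    have "(\<integral>\<^sup>+x. (\<Prod>i<Suc n. epowr (if i < n then F i x else 1) (if i < n then a i else b n)) \<partial>M)
       \<le> (\<Prod>i<Suc n. epowr (\<integral>\<^sup>+x. (if i < n then F i x else 1) \<partial>M) (if i < n then a i else b n))"
      by (rule Holder_finite_prod) (auto simp: a b, simp add: b_def)
    also have "\<dots> = epowr ?m (b n) * (\<Prod>i<n. epowr (\<integral>\<^sup>+x. F i x \<partial>M) (a i))"
      by (simp add: mult.commute)
    also have "\<dots> \<le> epowr ?m (b n) * (\<Prod>i<n. epowr (N i) (a i))"
      by (intro mult_left_mono prod_mono_ennreal epowr_mono N) (auto simp: a less_imp_le)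
    finally show ?thesis by simp
  qed
  have lim: "(\<lambda>n. epowr ?m (b n) * (\<Prod>i<n. epowr (N i) (a i))) \<longlonglongrightarrow> 1 * iprod (\<lambda>i. epowr (N i) (a i))"
    using M N(2) by (intro tendsto_mult_ennreal tendsto_epowr_exponent_0 b0 iprod_LIMSEQ)
       (auto simp: iprod_finite_def)
  have "(\<integral>\<^sup>+x. liminf (\<lambda>n. \<Prod>i<n. epowr (F i x) (a i)) \<partial>M)
      \<le> liminf (\<lambda>n. \<integral>\<^sup>+x. (\<Prod>i<n. epowr (F i x) (a i)) \<partial>M)"
    by (rule nn_integral_liminf) measurable
  also have "\<dots> \<le> liminf (\<lambda>n. epowr ?m (b n) * (\<Prod>i<n. epowr (N i) (a i)))"
    by (intro Liminf_mono always_eventually allI bound)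
  also have "\<dots> = iprod (\<lambda>i. epowr (N i) (a i))"
    using lim_imp_Liminf[OF _ lim] by simp
  finally show ?thesis .
qed

section \<open>Dyadic cubes\<close>

lemma mem_dyadic_cube_iff: "x \<in> dyadic_cube k m \<longleftrightarrow> (\<forall>j. \<lfloor>2 powi k * x $ j\<rfloor> = m $ j)"
proof -
  have "2 powi (-k) * of_int (m $ j) \<le> x $ j \<and> x $ j < 2 powi (-k) * (of_int (m $ j) + 1)
      \<longleftrightarrow> \<lfloor>2 powi k * x $ j\<rfloor> = m $ j" for j
  proof -
    have "2 powi (-k) * a = a / 2 powi k" for a :: real
      by (simp add: power_int_minus divide_inverse mult.commute)
    moreover have "(0::real) < 2 powi k" by simp
    ultimately show ?thesis
      by (simp add: floor_eq_iff pos_divide_le_eq pos_less_divide_eq mult.commute)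
  qed
  then show ?thesis by (simp add: dyadic_cube_def)
qed

text \<open>The integer coordinates at a coarse level are those at a finer level divided by a power
  of 2 and rounded down, so the fine cube of a point determines its coarse cube.\<close>

lemma dyadic_cube_mono_level:
  fixes x :: "real ^ 'n"
  assumes "k \<le> k'" "x \<in> dyadic_cube k m" "x \<in> dyadic_cube k' m'"
  shows "dyadic_cube k' m' \<subseteq> dyadic_cube k m"
proof
  fix y assume y: "y \<in> dyadic_cube k' m'"
  define d where "d = nat (k' - k)"
  have k': "k' = k + int d" using assms(1) by (simp add: d_def)
  have floor: "\<lfloor>2 powi k * z\<rfloor> = \<lfloor>2 powi k' * z\<rfloor> div 2 ^ d" for z :: real
  proof -
    have "2 powi k * z = 2 powi k' * z / real_of_int (2 ^ d)"
      by (simp add: k' power_int_add)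
    then show ?thesis by (metis floor_divide_real_eq_div zero_le_numeral zero_le_power)
  qed
  show "y \<in> dyadic_cube k m"
    using y assms(2,3) floor unfolding mem_dyadic_cube_iff by metis
qed

lemma dyadic_nested:
  assumes "A \<in> dyadic" "B \<in> dyadic" "A \<inter> B \<noteq> {}"
  shows "A \<subseteq> B \<or> B \<subseteq> A"
proof -
  obtain k m k' m' where AB: "A = dyadic_cube k m" "B = dyadic_cube k' m'"
    using assms(1,2) by (auto simp: dyadic_def dyadic_level_def)
  obtain x where x: "x \<in> A" "x \<in> B" using assms(3) by auto
  show ?thesis
  proof (cases "k \<le> k'")
    case True
    then show ?thesis using dyadic_cube_mono_level x unfolding AB by blast
  next
    case False
    then have "k' \<le> k" by simp
    then show ?thesis using dyadic_cube_mono_level x unfolding AB by blast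
  qed
qed

lemma countable_dyadic: "countable (dyadic :: (real ^ 'n) set set)"
  unfolding dyadic_def dyadic_level_def by simp

lemma dyadic_level_unique:
  assumes "A \<in> dyadic_level k" "B \<in> dyadic_level k" "x \<in> A" "x \<in> B"
  shows "A = B"
proof -
  obtain m m' where AB: "A = dyadic_cube k m" "B = dyadic_cube k m'"
    using assms(1,2) by (auto simp: dyadic_level_def)
  show ?thesis
    using dyadic_cube_mono_level[of k k x] assms(3,4) unfolding AB by blast
qed

lemma dyadic_sets:
  fixes B :: "(real ^ 'n) set"
  assumes "B \<in> dyadic"
  shows "B \<in> sets borel" "B \<in> sets lebesgue"
proof -
  have "dyadic_cube k m \<in> sets borel" for k and m :: "int ^ 'n"
    unfolding dyadic_cube_def by measurable
  then show "B \<in> sets borel" using assms by (auto simp: dyadic_def dyadic_level_def)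
  then show "B \<in> sets lebesgue" by auto
qed

text \<open>The half-open cube lies between the open and the closed box with the same
  corners.\<close>

lemma emeasure_dyadic:
  fixes B :: "(real ^ 'n) set"
  assumes "B \<in> dyadic"
  shows "emeasure lebesgue B \<noteq> 0" "emeasure lebesgue B < top"
proof -
  obtain k m where B: "B = dyadic_cube k m"
    using assms by (auto simp: dyadic_def dyadic_level_def)
  define a b :: "real ^ 'n"
    where "a = (\<chi> j. 2 powi (-k) * of_int (m $ j))" and "b = (\<chi> j. 2 powi (-k) * (of_int (m $ j) + 1))"
  have ab: "a $ j < b $ j" for j by (simp add: a_def b_def)
  have "box a b \<subseteq> B" by (auto simp: B dyadic_cube_def mem_box_cart a_def b_def less_imp_le)
  then have "emeasure lebesgue (box a b) \<le> emeasure lebesgue B"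
    using dyadic_sets(2)[OF assms] by (rule emeasure_mono)
  moreover have "emeasure lebesgue (box a b) \<noteq> 0"
    using ab negligible_iff_emeasure0[of "box a b"] interval_ne_empty_cart(2)[of a b]
    by (simp add: negligible_interval)
  ultimately show "emeasure lebesgue B \<noteq> 0" by auto
  have "B \<subseteq> cbox a b" by (auto simp: B dyadic_cube_def mem_box_cart a_def b_def less_imp_le)
  then have "emeasure lebesgue B \<le> emeasure lebesgue (cbox a b)"
    by (intro emeasure_mono) auto
  also have "\<dots> < top" using emeasure_lborel_cbox_finite[of a b] by simp
  finally show "emeasure lebesgue B < top" .
qed

lemma inverse_emeasure_dyadic:
  fixes B :: "(real ^ 'n) set"
  assumes "B \<in> dyadic"
  defines "D \<equiv> emeasure lebesgue B"
  shows "inverse D \<noteq> 0" "inverse D < top" "D * inverse D = 1"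
proof -
  have D: "D \<noteq> 0" "D \<noteq> top" using emeasure_dyadic[OF assms(1)] by (auto simp: D_def)
  then show "inverse D \<noteq> 0" "inverse D < top"
    by (auto simp: less_top[symmetric])
  have "D / D = 1" using D mult_divide_eq_ennreal[of D 1] by simp
  then show "D * inverse D = 1" by (simp add: divide_ennreal_def)
qed

lemma average_mult_emeasure:
  assumes "B \<in> dyadic"
  shows "average f B * emeasure lebesgue B = (\<integral>\<^sup>+y\<in>B. ennreal (f y) \<partial>lebesgue)"
  using emeasure_dyadic[OF assms] unfolding average_def
  by (subst ennreal_divide_times, subst ennreal_times_divide, intro mult_divide_eq_ennreal) auto

text \<open>Cubes of one level that share a point coincide, so a single term of the sum survives.
  This turns the assumption on conditional expectations into one on averages.\<close>

lemma cond_exp_dyadic_eq: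
  assumes "B \<in> dyadic_level k" "x \<in> B"
  shows "cond_exp_dyadic k f x = average f B"
proof -
  have "cond_exp_dyadic k f x = (\<Sum>\<^sub>\<infinity>A\<in>{B}. average f A * indicator A x)"
    unfolding cond_exp_dyadic_def
  proof (rule infsum_cong_neutral)
    fix A assume "A \<in> dyadic_level k - {B}"
    then have "x \<notin> A" using dyadic_level_unique[OF _ assms(1) _ assms(2)] by blast
    then show "average f A * indicator A x = 0" by simp
  qed (use assms in auto)
  then show ?thesis using assms by simp
qed

text \<open>Take the members maximal under inclusion: nestedness makes them disjoint, and finiteness
  puts every member inside a maximal one.\<close>

lemma maximal_dyadic_subfamily:
  fixes F :: "(real ^ 'n) set set"
  assumes "finite F" "F \<subseteq> dyadic"
  obtains G where "G \<subseteq> F" "pairwise disjnt G" "\<Union>G = \<Union>F"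
proof -
  define G where "G = {B \<in> F. \<forall>A\<in>F. B \<subseteq> A \<longrightarrow> B = A}"
  show ?thesis
  proof
    show "G \<subseteq> F" by (auto simp: G_def)
    show "pairwise disjnt G"
    proof (rule pairwiseI)
      fix A B assume AB: "A \<in> G" "B \<in> G" "A \<noteq> B"
      then have "\<not> A \<subseteq> B" "\<not> B \<subseteq> A" by (auto simp: G_def)
      then show "disjnt A B"
        using dyadic_nested[of A B] AB(1,2) assms(2) unfolding G_def disjnt_def by blast
    qed
    show "\<Union>G = \<Union>F"
    proof
      show "\<Union>F \<subseteq> \<Union>G"
      proof
        fix x assume "x \<in> \<Union>F"
        then obtain B where B: "B \<in> F" "x \<in> B" by auto
        then obtain A where "A \<in> F" "B \<subseteq> A" "\<forall>C\<in>F. A \<subseteq> C \<longrightarrow> A = C"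
          using finite_has_maximal2[OF assms(1) B(1)] by auto
        then show "x \<in> \<Union>G" using B unfolding G_def by blast
      qed
    qed (auto simp: G_def)
  qed
qed

section \<open>Weights and weighted norms\<close>

text \<open>Lets the threshold \<open>l\<close> increase to \<open>L\<close>. For \<open>V\<close>
  in \<open>(0,\<infinity>)\<close> one divides by \<open>V\<close>; for infinite \<open>V\<close> a
  single positive threshold already forces \<open>K = top\<close>.\<close>

lemma ennreal_mult_le_if_less_le:
  fixes L V K :: ennreal
  assumes "\<And>l. 0 < l \<Longrightarrow> ennreal l < L \<Longrightarrow> ennreal l * V \<le> K"
  shows "L * V \<le> K"
proof -
  have z: "z * V \<le> K" if "z < L" for z
  proof (cases z)
    case (real r)
    then show ?thesis using that assms[of r] by (cases "r = 0") auto
  qed (use that in auto)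
  consider "L = 0 \<or> V = 0" | "L \<noteq> 0" "V = top" | "V \<noteq> 0" "V \<noteq> top" by auto
  then show ?thesis
  proof cases
    case 2
    then obtain z where "0 < z" "z < L" using dense[of 0 L] by (auto simp: zero_less_iff_neq_zero)
    then show ?thesis using z[of z] 2 by (simp add: ennreal_mult_top top_unique zero_less_iff_neq_zero)
  next
    case 3
    have "L \<le> K / V"
    proof (rule dense_le)
      fix z assume "z < L"
      from z[OF this] have "z * V / V \<le> K / V" by (rule divide_right_mono_ennreal)
      then show "z \<le> K / V" using 3 by (simp add: mult_divide_eq_ennreal)
    qed
    then have "L * V \<le> K / V * V" by (rule mult_right_mono) simp
    also have "\<dots> = K"
      using 3 by (subst ennreal_divide_times, subst ennreal_times_divide, intro mult_divide_eq_ennreal) auto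
    finally show ?thesis .
  qed auto
qed

lemma wmeasure_eq_emeasure_density:
  assumes "v \<in> borel_measurable lebesgue" "E \<in> sets lebesgue"
  shows "wmeasure v E = emeasure (density lebesgue (\<lambda>x. ennreal (v x))) E"
  unfolding wmeasure_def using assms by (subst emeasure_density) auto

lemma wmeasure_mono: "A \<subseteq> B \<Longrightarrow> wmeasure v A \<le> wmeasure v B"
  unfolding wmeasure_def by (intro nn_integral_mono) (auto split: split_indicator)

text \<open>Used with the reciprocal of the measure of a cube, to merge its powers
  \<open>1 / p_i\<close> into the single power \<open>1 / p\<close>.\<close>

lemma iprod_epowr_exponents:
  assumes "m \<noteq> 0" "m < top" "a sums s"
  shows "iprod_finite (\<lambda>i. epowr m (a i))" "iprod (\<lambda>i. epowr m (a i)) = epowr m s"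
proof -
  obtain r where r: "m = ennreal r" "0 < r"
    using assms(1,2) by (cases m) (auto simp: less_le)
  have eq: "(\<Prod>i<n. epowr m (a i)) = ennreal (r powr (\<Sum>i<n. a i))" for n
    using r by (simp add: prod_ennreal powr_sum less_imp_le)
  have "(\<lambda>n. ennreal (r powr (\<Sum>i<n. a i))) \<longlonglongrightarrow> ennreal (r powr s)"
    using assms(3) r by (intro tendsto_ennrealI tendsto_powr) (auto simp: sums_def)
  then have "(\<lambda>n. \<Prod>i<n. epowr m (a i)) \<longlonglongrightarrow> epowr m s"
    unfolding eq using r by simp
  from iprod_eqI[OF this] r
  show "iprod_finite (\<lambda>i. epowr m (a i))" "iprod (\<lambda>i. epowr m (a i)) = epowr m s"
    by (auto simp: iprod_finite_def)
qed

lemma wnorm_indicator: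
  "wnorm q w (\<lambda>x. f x * indicator B x) = epowr (\<integral>\<^sup>+x\<in>B. ennreal (\<bar>f x\<bar> powr q * w x) \<partial>lebesgue) (1 / q)"
  unfolding wnorm_def
  by (intro arg_cong2[where f = epowr] nn_integral_cong) (auto split: split_indicator)

lemma wnorm_indicator_le: "0 < q \<Longrightarrow> wnorm q w (\<lambda>x. f x * indicator B x) \<le> wnorm q w f"
  unfolding wnorm_indicator
  unfolding wnorm_def by (intro epowr_mono nn_integral_mono) (auto split: split_indicator)

lemma borel_measurable_dual_weight [measurable (raw)]:
  "w \<in> borel_measurable lebesgue \<Longrightarrow> dual_weight q w \<in> borel_measurable lebesgue"
  unfolding dual_weight_def[abs_def] by measurable

text \<open>With \<sigma> the dual weight, \<sigma> to the power q times w equals \<sigma> almost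
  everywhere, because \<open>-q / (q - 1) + 1 = -1 / (q - 1)\<close>.\<close>

lemma wnorm_dual_weight:
  assumes "1 < q" "AE x in lebesgue. 0 < w x"
  shows "wnorm q w (\<lambda>x. dual_weight q w x * indicator B x)
    = epowr (\<integral>\<^sup>+x\<in>B. ennreal (dual_weight q w x) \<partial>lebesgue) (1 / q)"
proof -
  have "AE x in lebesgue. \<bar>dual_weight q w x\<bar> powr q * w x = dual_weight q w x"
    using assms(2)
  proof eventually_elim
    case (elim x)
    have "\<bar>dual_weight q w x\<bar> powr q * w x = w x powr (- 1 / (q - 1) * q) * w x powr 1"
      using elim by (simp only: dual_weight_def powr_powr abs_of_nonneg powr_ge_zero powr_one)
    also have "\<dots> = w x powr (- 1 / (q - 1) * q + 1)" by (simp only: powr_add)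
    also have "- 1 / (q - 1) * q + 1 = - 1 / (q - 1)" using assms(1) by (simp add: divide_simps)
    finally show ?case by (simp add: dual_weight_def)
  qed
  then show ?thesis
    unfolding wnorm_indicator by (intro arg_cong2[where f = epowr] nn_integral_cong_AE) auto
qed

text \<open>Write f as the \<open>1 / q\<close> power of \<open>f powr q * w\<close> times the
  \<open>1 / conj_exponent q\<close> power of the dual weight; the powers of w cancel.\<close>

lemma Holder_dual_weight:
  assumes "1 < q" and [measurable]: "w \<in> borel_measurable lebesgue" "f \<in> borel_measurable lebesgue" "B \<in> sets lebesgue"
    and "AE x in lebesgue. 0 < w x" and f: "\<And>x. 0 \<le> f x"
  shows "(\<integral>\<^sup>+x\<in>B. ennreal (f x) \<partial>lebesgue)
    \<le> wnorm q w (\<lambda>x. f x * indicator B x)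
      * epowr (\<integral>\<^sup>+x\<in>B. ennreal (dual_weight q w x) \<partial>lebesgue) (1 / conj_exponent q)"
proof -
  define F where "F x = ennreal (\<bar>f x\<bar> powr q * w x) * indicator B x" for x
  define G where "G x = ennreal (dual_weight q w x) * indicator B x" for x
  have "AE x in lebesgue. ennreal (f x) * indicator B x
      = epowr (F x) (1 / q) * epowr (G x) (1 / conj_exponent q)"
    using assms(5)
  proof eventually_elim
    case (elim x)
    show ?case
    proof (cases "x \<in> B")
      case True
      have "epowr (F x) (1 / q) * epowr (G x) (1 / conj_exponent q)
          = ennreal ((f x powr q * w x) powr (1 / q) * (w x powr (- 1 / (q - 1))) powr (1 / conj_exponent q))"
        using elim True f[of x] by (simp add: F_def G_def dual_weight_def ennreal_mult'[symmetric])
      also have "(f x powr q * w x) powr (1 / q) = f x * w x powr (1 / q)"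
        using elim f[of x] assms(1) by (simp add: powr_mult powr_powr)
      also have "(w x powr (- 1 / (q - 1))) powr (1 / conj_exponent q) = w x powr (- (1 / q))"
        using assms(1) by (simp add: powr_powr conj_exponent_def)
      also have "f x * w x powr (1 / q) * w x powr (- (1 / q)) = f x"
        using elim by (simp add: powr_minus)
      finally show ?thesis using True by simp
    qed (simp add: F_def)
  qed
  then have "(\<integral>\<^sup>+x\<in>B. ennreal (f x) \<partial>lebesgue)
      = (\<integral>\<^sup>+x. epowr (F x) (1 / q) * epowr (G x) (1 / conj_exponent q) \<partial>lebesgue)"
    by (rule nn_integral_cong_AE)
  also have "\<dots> \<le> epowr (\<integral>\<^sup>+x. F x \<partial>lebesgue) (1 / q) * epowr (\<integral>\<^sup>+x. G x \<partial>lebesgue) (1 / conj_exponent q)"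
    using assms(1) by (intro Holder_two) (auto simp: F_def G_def conj_exponent_def field_simps)
  finally show ?thesis by (simp add: wnorm_indicator F_def G_def)
qed

text \<open>The factor \<open>1 / |B|\<close> is split by conjugate exponents: one part turns the
  integral of the dual weight into an average, the other is kept for the product over all i.\<close>

lemma average_le_wnorm:
  assumes "1 < q" "w \<in> borel_measurable lebesgue" "f \<in> borel_measurable lebesgue" "B \<in> dyadic"
    and "AE x in lebesgue. 0 < w x" "\<And>x. 0 \<le> f x"
  shows "average f B \<le> epowr (inverse (emeasure lebesgue B)) (1 / q)
      * epowr (average (dual_weight q w) B) (1 / conj_exponent q)
      * wnorm q w (\<lambda>x. f x * indicator B x)"
proof -
  define D where "D = emeasure lebesgue B"
  note D = inverse_emeasure_dyadic(3)[OF assms(4), folded D_def]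
  define N where "N = wnorm q w (\<lambda>x. f x * indicator B x)"
  define r where "r = 1 / conj_exponent q"
  define A where "A = average (dual_weight q w) B"
  have qr: "1 / q + r = 1" using assms(1) by (simp add: r_def conj_exponent_def field_simps)
  have "average f B \<le> N * epowr (A * D) r * inverse D"
    using Holder_dual_weight[OF assms(1,2,3) dyadic_sets(2)[OF assms(4)] assms(5,6)]
      average_mult_emeasure[OF assms(4), of "dual_weight q w"]
    by (simp add: average_def[of f] divide_ennreal_def N_def A_def D_def r_def mult_right_mono)
  also have "inverse D = epowr (inverse D) (1 / q) * epowr (inverse D) r"
    using epowr_add[of "inverse D" "1 / q" r] by (simp add: qr)
  also have "N * epowr (A * D) r * (epowr (inverse D) (1 / q) * epowr (inverse D) r)
      = epowr (inverse D) (1 / q) * epowr A r * N * epowr (D * inverse D) r"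
    by (simp add: epowr_mult mult_ac)
  also have "\<dots> = epowr (inverse D) (1 / q) * epowr A r * N" by (simp add: D)
  finally show ?thesis by (simp add: N_def A_def D_def r_def)
qed

lemma indicator_times_self: "indicator B x * indicator B x = (indicator B x :: real)"
  by (simp add: indicator_def)

section \<open>Equivalence of the bounds\<close>

locale infinite_weights =
  fixes p :: real and ps :: "nat \<Rightarrow> real"
    and v :: "real ^ 'n \<Rightarrow> real" and w :: "nat \<Rightarrow> real ^ 'n \<Rightarrow> real"
  assumes ps: "\<And>i. 1 < ps i"
    and p_sums: "(\<lambda>i. 1 / ps i) sums (1 / p)"
    and v: "weight v"
    and w: "\<And>i. weight (w i)"
    and standing: "standing_assumptions ps w"
begin

abbreviation "\<sigma> i \<equiv> dual_weight (ps i) (w i)"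

lemma ps_pos: "0 < ps i"
  using ps[of i] by simp

text \<open>A series of positive terms has a positive sum; this also excludes \<open>p = 0\<close>,
  for which \<open>1 / p\<close> would be 0.\<close>

lemma p_pos: "0 < p"
proof -
  have "0 < (\<Sum>i. 1 / ps i)"
    using p_sums ps_pos by (intro suminf_pos) (auto simp: sums_iff)
  then show ?thesis using p_sums by (simp add: sums_iff)
qed

text \<open>The numbers \<open>p / p_i\<close> are the exponents for both uses of the infinite
  Hoelder inequality.\<close>

lemma exponents_sums: "(\<lambda>i. 1 / ps i * p) sums 1"
  using sums_mult2[OF p_sums, of p] p_pos by simp

lemma v_meas [measurable]: "v \<in> borel_measurable lebesgue"
  using v by (simp add: weight_def)

lemma w_meas [measurable]: "w i \<in> borel_measurable lebesgue"
  using w by (simp add: weight_def)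

lemma w_pos: "AE x in lebesgue. 0 < w i x"
  using w by (simp add: weight_def)

lemma product_spaceD:
  assumes "f \<in> product_space ps w"
  shows "f i \<in> borel_measurable lebesgue" "0 \<le> f i x" "wnorm (ps i) (w i) (f i) < top"
    "iprod_finite (\<lambda>i. wnorm (ps i) (w i) (f i))"
  using assms by (auto simp: product_space_def)

text \<open>Each truncated norm is at most the original finite norm, so domination yields
  convergence of their product.\<close>

lemma product_space_indicator:
  assumes f: "f \<in> product_space ps w" and [measurable]: "B \<in> sets lebesgue"
  shows "(\<lambda>i x. f i x * indicator B x) \<in> product_space ps w"
proof -
  note [measurable] = product_spaceD(1)[OF f]
  have le: "wnorm (ps i) (w i) (\<lambda>x. f i x * indicator B x) \<le> wnorm (ps i) (w i) (f i)" for i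
    by (rule wnorm_indicator_le[OF ps_pos])
  have "wnorm (ps i) (w i) (\<lambda>x. f i x * indicator B x) < top" for i
    using le product_spaceD(3)[OF f] by (rule le_less_trans)
  moreover have "iprod_finite (\<lambda>i. wnorm (ps i) (w i) (\<lambda>x. f i x * indicator B x))"
    using product_spaceD(4,3)[OF f] le by (rule iprod_finite_dominated)
  ultimately show ?thesis
    using product_spaceD(2)[OF f] by (auto simp: product_space_def)
qed

lemma dual_weight_in_product_space:
  "B \<in> dyadic \<Longrightarrow> (\<lambda>i x. \<sigma> i x * indicator B x) \<in> product_space ps w"
  using standing by (auto simp: standing_assumptions_def)

text \<open>A cube has positive measure, hence contains a point at which the standing assumption can
  be read.\<close>

lemma iprod_finite_dual_averages:
  assumes "B \<in> dyadic"
  shows "iprod_finite (\<lambda>i. epowr (average (\<sigma> i) B) (1 / conj_exponent (ps i)))"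
proof -
  obtain k where k: "B \<in> dyadic_level k" using assms by (auto simp: dyadic_def)
  obtain x where x: "x \<in> B" using emeasure_dyadic(1)[OF assms] by (cases "B = {}") auto
  show ?thesis
    using standing unfolding standing_assumptions_def cond_exp_dyadic_eq[OF k x, symmetric] by blast
qed

lemma iprod_finite_dual_norms:
  assumes "B \<in> dyadic"
  shows "iprod_finite (\<lambda>i. epowr (\<integral>\<^sup>+x\<in>B. ennreal (\<sigma> i x) \<partial>lebesgue) (1 / ps i))"
    and "(\<integral>\<^sup>+x\<in>B. ennreal (\<sigma> i x) \<partial>lebesgue) < top"
  using product_spaceD(3,4)[OF dual_weight_in_product_space[OF assms]]
  by (simp_all add: wnorm_dual_weight ps w_pos)

lemma average_dual_less_top:
  assumes "B \<in> dyadic"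
  shows "average (\<sigma> i) B < top"
  using iprod_finite_dual_norms(2)[OF assms, of i] inverse_emeasure_dyadic[OF assms]
  by (simp add: average_def divide_ennreal_def ennreal_mult_less_top)

lemma average_dual_weight: "average (\<lambda>y. w i y powr (- 1 / (ps i - 1))) B = average (\<sigma> i) B"
  by (simp add: dual_weight_def[abs_def])

section \<open>The averaging bound against the condition on averages of the weights\<close>

text \<open>The single-function estimates are multiplied over i. Their right-hand sides form a
  product of three finite infinite products, which also gives convergence on the left.\<close>

lemma average_bounds:
  assumes f: "f \<in> product_space ps w" and B: "B \<in> dyadic"
  shows "iprod_finite (\<lambda>i. average (f i) B)"
    and "iprod (\<lambda>i. average (f i) B)
      \<le> epowr (inverse (emeasure lebesgue B)) (1 / p)
        * iprod (\<lambda>i. epowr (average (\<sigma> i) B) (1 / conj_exponent (ps i)))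
        * iprod (\<lambda>i. wnorm (ps i) (w i) (\<lambda>x. f i x * indicator B x))"
proof -
  define D where "D = inverse (emeasure lebesgue B)"
  note D = inverse_emeasure_dyadic(1,2)[OF B, folded D_def]
  note fB = product_spaceD[OF product_space_indicator[OF f dyadic_sets(2)[OF B]]]
  let ?d = "\<lambda>i. epowr D (1 / ps i) * epowr (average (\<sigma> i) B) (1 / conj_exponent (ps i))
      * wnorm (ps i) (w i) (\<lambda>x. f i x * indicator B x)"
  note DS = iprod_mult[OF iprod_epowr_exponents(1)[OF D p_sums] iprod_finite_dual_averages[OF B]]
  note DSN = iprod_mult[OF DS(1) fB(4)]
  have le: "average (f i) B \<le> ?d i" for i
    unfolding D_def
    using average_le_wnorm[OF ps w_meas product_spaceD(1)[OF f] B w_pos product_spaceD(2)[OF f]] .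
  have "?d i < top" for i
    using D average_dual_less_top[OF B] fB(3) by (simp add: ennreal_mult_less_top)
  with DSN(1) show fin: "iprod_finite (\<lambda>i. average (f i) B)"
    using le by (rule iprod_finite_dominated)
  have "iprod (\<lambda>i. average (f i) B) \<le> iprod ?d"
    using fin DSN(1) le by (intro iprod_mono) (auto simp: iprod_finite_def)
  then show "iprod (\<lambda>i. average (f i) B)
      \<le> epowr (inverse (emeasure lebesgue B)) (1 / p)
        * iprod (\<lambda>i. epowr (average (\<sigma> i) B) (1 / conj_exponent (ps i)))
        * iprod (\<lambda>i. wnorm (ps i) (w i) (\<lambda>x. f i x * indicator B x))"
    unfolding DSN(2) DS(2) iprod_epowr_exponents(2)[OF D p_sums] by (simp only: D_def)
qed

lemma Ap_bound_imp_averaging_bound: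
  assumes "Ap_bound p ps v w C"
  shows "averaging_bound p ps v w C"
  unfolding averaging_bound_def
proof (intro ballI)
  fix f B assume f: "f \<in> product_space ps w" and B: "B \<in> (dyadic :: (real ^ 'n) set set)"
  let ?D = "emeasure lebesgue B"
  let ?S = "iprod (\<lambda>i. epowr (average (\<sigma> i) B) (1 / conj_exponent (ps i)))"
  let ?N = "iprod (\<lambda>i. wnorm (ps i) (w i) (\<lambda>x. f i x * indicator B x))"
  note D = inverse_emeasure_dyadic(3)[OF B]
  have "epowr (wmeasure v B) (1 / p) * iprod (\<lambda>i. average (f i) B)
      \<le> epowr (average v B * ?D) (1 / p) * (epowr (inverse ?D) (1 / p) * ?S * ?N)"
    using average_bounds(2)[OF f B]
    by (simp add: average_mult_emeasure[OF B] wmeasure_def mult_left_mono)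
  \<comment> \<open>The power of \<open>|B|\<close> from \<open>wmeasure v B\<close> cancels the one
    left over from the averages.\<close>
  also have "\<dots> = epowr (average v B) (1 / p) * ?S * ?N * epowr (?D * inverse ?D) (1 / p)"
    by (simp add: epowr_mult mult_ac)
  also have "\<dots> = epowr (average v B) (1 / p) * ?S * ?N" by (simp only: D epowr_one mult_1_right)
  also have "\<dots> \<le> ennreal C * ?N"
    using assms B unfolding Ap_bound_def average_dual_weight by (intro mult_right_mono) auto
  finally show "epowr (wmeasure v B) (1 / p) * iprod (\<lambda>i. average (f i) B) \<le> ennreal C * ?N" .
qed

text \<open>The standing assumption \<open>0 < iprod \<dots>\<close> holds pointwise; Hoelder's inequality on \<open>B\<close> with
  the exponents \<open>p\<^sub>i / p\<close> transfers it to the integrals.\<close>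

lemma iprod_dual_norms_pos:
  assumes B: "B \<in> dyadic"
  shows "iprod (\<lambda>i. epowr (\<integral>\<^sup>+x\<in>B. ennreal (\<sigma> i x) \<partial>lebesgue) (1 / ps i)) \<noteq> 0"
proof
  assume zero: "iprod (\<lambda>i. epowr (\<integral>\<^sup>+x\<in>B. ennreal (\<sigma> i x) \<partial>lebesgue) (1 / ps i)) = 0"
  define N where "N i = (\<integral>\<^sup>+x\<in>B. ennreal (\<sigma> i x) \<partial>lebesgue)" for i
  define M where "M = restrict_space lebesgue B"
  have BL: "B \<in> sets lebesgue" using B by (rule dyadic_sets)
  have [measurable]: "(\<lambda>x. ennreal (\<sigma> i x)) \<in> borel_measurable M" for i
    unfolding M_def by (intro measurable_restrict_space1) measurable
  have N: "(\<integral>\<^sup>+x. ennreal (\<sigma> i x) \<partial>M) = N i" for i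
    unfolding M_def N_def using BL by (intro nn_integral_restrict_space) auto
  have M: "emeasure M (space M) = emeasure lebesgue B"
    using BL by (simp add: M_def emeasure_restrict_space space_restrict_space)
  \<comment> \<open>The power p turns the exponents \<open>1 / p_i\<close> into
    \<open>p / p_i\<close>, which sum to 1.\<close>
  note pow = iprod_epowr[OF iprod_finite_dual_norms(1)[OF B] p_pos, unfolded epowr_epowr]
  let ?g = "\<lambda>x. liminf (\<lambda>n. \<Prod>i<n. epowr (ennreal (\<sigma> i x)) (1 / ps i * p))"
  have "(\<integral>\<^sup>+x. ?g x \<partial>M) \<le> iprod (\<lambda>i. epowr (N i) (1 / ps i * p))"
    using emeasure_dyadic[OF B] ps_pos p_pos pow(1)
    by (intro Holder_iprod exponents_sums) (auto simp: M N, simp add: N_def)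
  also have "\<dots> = 0" using pow(2) zero by (simp add: N_def)
  finally have "AE x in M. ?g x = 0"
    by (subst (asm) le_zero_eq, subst (asm) nn_integral_0_iff_AE) auto
  moreover have "AE x in M. ?g x \<noteq> 0"
    unfolding M_def
  proof (subst AE_restrict_space_iff)
    have "AE x in lebesgue. iprod_converges (\<lambda>i. ennreal (\<sigma> i x powr (1 / ps i))) \<and>
        0 < iprod (\<lambda>i. ennreal (\<sigma> i x powr (1 / ps i)))"
      using standing by (simp add: standing_assumptions_def)
    then show "AE x in lebesgue. x \<in> B \<longrightarrow> ?g x \<noteq> 0"
    proof eventually_elim
      case (elim x)
      \<comment> \<open>A level strictly between 0 and the limit eventually bounds the partial
        products from below, which keeps the liminf positive.\<close>
      then obtain c where c: "0 < c" "c < iprod (\<lambda>i. ennreal (\<sigma> i x powr (1 / ps i)))"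
        using dense by blast
      have "eventually (\<lambda>n. c < (\<Prod>i<n. ennreal (\<sigma> i x powr (1 / ps i)))) sequentially"
        using iprod_LIMSEQ c elim by (intro order_tendstoD(1)) auto
      then have "eventually (\<lambda>n. epowr c p \<le> (\<Prod>i<n. epowr (ennreal (\<sigma> i x)) (1 / ps i * p))) sequentially"
      proof eventually_elim
        case (elim n)
        then have "epowr c p \<le> epowr (\<Prod>i<n. ennreal (\<sigma> i x powr (1 / ps i))) p"
          using p_pos by (intro epowr_mono) auto
        then show ?case
          by (simp only: epowr_prod epowr_epowr[symmetric] epowr_ennreal dual_weight_def powr_ge_zero)
      qed
      then have "epowr c p \<le> ?g x" by (rule Liminf_bounded)
      then show ?case using c(1) by (metis epowr_eq_0_iff le_zero_eq less_irrefl)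
    qed
  qed (use BL in auto)
  ultimately have "AE x in M. False" by eventually_elim simp
  then have "emeasure M (space M) = 0" by (simp add: AE_iff_measurable[OF sets.top])
  then show False using emeasure_dyadic[OF B] by (simp add: M)
qed

lemma averaging_bound_imp_Ap_bound:
  assumes "averaging_bound p ps v w C"
  shows "Ap_bound p ps v w C"
  unfolding Ap_bound_def
proof (intro ballI)
  fix B assume B: "B \<in> (dyadic :: (real ^ 'n) set set)"
  let ?D = "emeasure lebesgue B"
  let ?S = "iprod (\<lambda>i. epowr (average (\<sigma> i) B) (1 / conj_exponent (ps i)))"
  define P where "P = iprod (\<lambda>i. epowr (\<integral>\<^sup>+x\<in>B. ennreal (\<sigma> i x) \<partial>lebesgue) (1 / ps i))"
  have P: "P \<noteq> 0" "P < top"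
    using iprod_dual_norms_pos[OF B] iprod_finite_dual_norms(1)[OF B]
    by (auto simp: P_def iprod_finite_def)
  note D = inverse_emeasure_dyadic[OF B]
  \<comment> \<open>For the dual weight the Hoelder estimate of an average is an equality, so
    testing loses no constant.\<close>
  have avg: "average (\<lambda>x. \<sigma> i x * indicator B x) B = epowr (inverse ?D) (1 / ps i)
      * epowr (average (\<sigma> i) B) (1 / conj_exponent (ps i))
      * epowr (\<integral>\<^sup>+x\<in>B. ennreal (\<sigma> i x) \<partial>lebesgue) (1 / ps i)" for i
  proof -
    have "average (\<lambda>x. \<sigma> i x * indicator B x) B = average (\<sigma> i) B"
      unfolding average_def
      by (intro arg_cong2[where f = "(/)"] nn_integral_cong) (auto split: split_indicator)
    also have "\<dots> = epowr (average (\<sigma> i) B) (1 / ps i + 1 / conj_exponent (ps i))"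
    proof -
      have "1 / ps i + 1 / conj_exponent (ps i) = 1"
        using ps[of i] by (simp add: conj_exponent_def field_simps)
      then show ?thesis by simp
    qed
    also have "\<dots> = epowr (average (\<sigma> i) B) (1 / ps i) * epowr (average (\<sigma> i) B) (1 / conj_exponent (ps i))"
      by (rule epowr_add)
    also have "epowr (average (\<sigma> i) B) (1 / ps i)
        = epowr (inverse ?D) (1 / ps i) * epowr (\<integral>\<^sup>+x\<in>B. ennreal (\<sigma> i x) \<partial>lebesgue) (1 / ps i)"
      by (simp add: average_def divide_ennreal_def epowr_mult mult.commute)
    finally show ?thesis by (simp add: mult_ac)
  qed
  note DS = iprod_mult[OF iprod_epowr_exponents(1)[OF D(1,2) p_sums] iprod_finite_dual_averages[OF B]]
  have prod_avg: "iprod (\<lambda>i. average (\<lambda>x. \<sigma> i x * indicator B x) B) = epowr (inverse ?D) (1 / p) * ?S * P"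
    unfolding avg P_def
    by (simp add: iprod_mult(2)[OF DS(1) iprod_finite_dual_norms(1)[OF B]] DS(2)
         iprod_epowr_exponents(2)[OF D(1,2) p_sums])
  have norm: "iprod (\<lambda>i. wnorm (ps i) (w i) (\<lambda>x. \<sigma> i x * indicator B x * indicator B x)) = P"
    unfolding P_def
    by (simp only: wnorm_dual_weight[OF ps w_pos, symmetric] mult.assoc indicator_times_self)
  have "epowr (average v B) (1 / p) * ?S * P
      = epowr (average v B) (1 / p) * ?S * P * epowr (?D * inverse ?D) (1 / p)"
    by (simp only: D epowr_one mult_1_right)
  also have "\<dots> = epowr (average v B * ?D) (1 / p) * (epowr (inverse ?D) (1 / p) * ?S * P)"
    by (simp add: epowr_mult mult_ac)
  also have "\<dots> = epowr (wmeasure v B) (1 / p) * iprod (\<lambda>i. average (\<lambda>x. \<sigma> i x * indicator B x) B)"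
    by (simp add: average_mult_emeasure[OF B] wmeasure_def prod_avg)
  also have "\<dots> \<le> ennreal C * P"
    using assms[unfolded averaging_bound_def, rule_format, OF dual_weight_in_product_space[OF B] B]
    unfolding norm .
  \<comment> \<open>\<open>P\<close> may be cancelled because it is neither 0 nor infinite.\<close>
  finally have "epowr (average v B) (1 / p) * ?S * P / P \<le> ennreal C * P / P"
    by (rule divide_right_mono_ennreal)
  then have "epowr (average v B) (1 / p) * ?S \<le> ennreal C"
    using P by (simp add: mult_divide_eq_ennreal)
  then show "epowr (average v B) (1 / p) *
       iprod (\<lambda>i. epowr (average (\<lambda>y. w i y powr (- 1 / (ps i - 1))) B) (1 / conj_exponent (ps i)))
     \<le> ennreal C"
    unfolding average_dual_weight .
qed

section \<open>Weak type bounds for the maximal operator\<close>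

text \<open>Infinite Hoelder for the counting measure on \<open>G\<close> with exponents
  \<open>p / p_i\<close>. For each i, disjointness bounds the sum of the integrals over the cubes by
  the full integral. Nonempty finite \<open>G\<close> has the required positive finite mass.\<close>

lemma sum_iprod_wnorm_le:
  assumes f: "f \<in> product_space ps w" and G: "finite G" "G \<subseteq> dyadic" "pairwise disjnt G"
  shows "(\<Sum>B\<in>G. epowr (iprod (\<lambda>i. wnorm (ps i) (w i) (\<lambda>x. f i x * indicator B x))) p)
    \<le> epowr (iprod (\<lambda>i. wnorm (ps i) (w i) (f i))) p"
proof (cases "G = {}")
  case False
  note [measurable] = product_spaceD(1)[OF f]
  define M where "M i = density lebesgue (\<lambda>x. ennreal (\<bar>f i x\<bar> powr ps i * w i x))" for i
  have sets: "G \<subseteq> sets lebesgue" using G(2) dyadic_sets by blast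
  have norm: "wnorm (ps i) (w i) (f i) = epowr (emeasure (M i) UNIV) (1 / ps i)" for i
    unfolding wnorm_def M_def by (subst emeasure_density) auto
  have norm_B: "wnorm (ps i) (w i) (\<lambda>x. f i x * indicator B x) = epowr (emeasure (M i) B) (1 / ps i)"
    if "B \<in> G" for i B
    unfolding wnorm_indicator M_def using that sets by (subst emeasure_density) auto
  have sum_le: "(\<Sum>B\<in>G. emeasure (M i) B) \<le> emeasure (M i) UNIV" for i
  proof -
    have "(\<Sum>B\<in>G. emeasure (M i) B) = emeasure (M i) (\<Union>B\<in>G. B)"
      using G sets by (intro sum_emeasure) (auto simp: M_def disjoint_family_on_def pairwise_def disjnt_def)
    also have "\<dots> \<le> emeasure (M i) UNIV"
      by (intro emeasure_mono) (auto simp: M_def)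
    finally show ?thesis .
  qed
  note pow = iprod_epowr[OF product_spaceD(4)[OF f] p_pos]
  have lim: "liminf (\<lambda>n. \<Prod>i<n. epowr (emeasure (M i) B) (1 / ps i * p))
      = epowr (iprod (\<lambda>i. wnorm (ps i) (w i) (\<lambda>x. f i x * indicator B x))) p" if B: "B \<in> G" for B
  proof (rule lim_imp_Liminf)
    have "iprod_finite (\<lambda>i. wnorm (ps i) (w i) (\<lambda>x. f i x * indicator B x))"
      using product_spaceD(4)[OF product_space_indicator[OF f]] sets B by blast
    from iprod_epowr[OF this p_pos]
    show "(\<lambda>n. \<Prod>i<n. epowr (emeasure (M i) B) (1 / ps i * p))
      \<longlonglongrightarrow> epowr (iprod (\<lambda>i. wnorm (ps i) (w i) (\<lambda>x. f i x * indicator B x))) p"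
      using iprod_LIMSEQ[of "\<lambda>i. epowr (wnorm (ps i) (w i) (\<lambda>x. f i x * indicator B x)) p"]
      by (simp add: iprod_finite_def norm_B[OF B] epowr_epowr)
  qed simp
  have "(\<Sum>B\<in>G. epowr (iprod (\<lambda>i. wnorm (ps i) (w i) (\<lambda>x. f i x * indicator B x))) p)
      = (\<integral>\<^sup>+B. liminf (\<lambda>n. \<Prod>i<n. epowr (emeasure (M i) B) (1 / ps i * p)) \<partial>count_space G)"
    using G(1) by (simp add: nn_integral_count_space_finite lim del: times_divide_eq_left)
  also have "\<dots> \<le> iprod (\<lambda>i. epowr (emeasure (M i) UNIV) (1 / ps i * p))"
    using G(1) False ps_pos p_pos sum_le pow(1)
    by (intro Holder_iprod exponents_sums)
       (auto simp: nn_integral_count_space_finite norm epowr_epowr emeasure_count_space of_nat_less_top)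
  also have "\<dots> = epowr (iprod (\<lambda>i. wnorm (ps i) (w i) (f i))) p"
    using pow(2) by (simp add: norm epowr_epowr)
  finally show ?thesis .
qed simp

text \<open>On a maximal, hence disjoint, subfamily the averaging bound is raised to the power p,
  which makes the left-hand sides additive in the cubes, and summed.\<close>

lemma wmeasure_Union_dyadic_le:
  assumes avg: "averaging_bound p ps v w C" and f: "f \<in> product_space ps w"
    and F: "finite F" "F \<subseteq> dyadic" "\<And>B. B \<in> F \<Longrightarrow> l \<le> iprod (\<lambda>i. average (f i) B)"
  shows "epowr l p * wmeasure v (\<Union>F)
    \<le> epowr (ennreal C * iprod (\<lambda>i. wnorm (ps i) (w i) (f i))) p"
proof -
  obtain G where G: "G \<subseteq> F" "pairwise disjnt G" "\<Union>G = \<Union>F"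
    using maximal_dyadic_subfamily[OF F(1,2)] by blast
  have finG: "finite G" using G(1) F(1) by (rule finite_subset)
  have dyG: "G \<subseteq> dyadic" using G(1) F(2) by blast
  then have sets: "G \<subseteq> sets lebesgue" using dyadic_sets by blast
  let ?P = "\<lambda>B. iprod (\<lambda>i. wnorm (ps i) (w i) (\<lambda>x. f i x * indicator B x))"
  have B: "epowr l p * wmeasure v B \<le> epowr (ennreal C) p * epowr (?P B) p" if "B \<in> G" for B
  proof -
    have "epowr (wmeasure v B) (1 / p) * l
        \<le> epowr (wmeasure v B) (1 / p) * iprod (\<lambda>i. average (f i) B)"
      using F(3) G(1) that by (intro mult_left_mono) auto
    also have "\<dots> \<le> ennreal C * ?P B"
      using avg f dyG that by (auto simp: averaging_bound_def)
    finally have "epowr (epowr (wmeasure v B) (1 / p) * l) p \<le> epowr (ennreal C * ?P B) p"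
      using p_pos by (intro epowr_mono) auto
    then show ?thesis using p_pos by (simp add: epowr_mult epowr_epowr mult.commute)
  qed
  have "wmeasure v (\<Union>F) = emeasure (density lebesgue (\<lambda>x. ennreal (v x))) (\<Union>B\<in>G. B)"
    unfolding G(3)[symmetric] using finG sets by (subst wmeasure_eq_emeasure_density) auto
  also have "\<dots> = (\<Sum>B\<in>G. emeasure (density lebesgue (\<lambda>x. ennreal (v x))) B)"
    using G(2) finG sets
    by (intro sum_emeasure[symmetric]) (auto simp: disjoint_family_on_def pairwise_def disjnt_def)
  also have "\<dots> = (\<Sum>B\<in>G. wmeasure v B)"
    using sets by (intro sum.cong) (auto simp: wmeasure_eq_emeasure_density)
  finally have "epowr l p * wmeasure v (\<Union>F) = (\<Sum>B\<in>G. epowr l p * wmeasure v B)"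
    by (simp add: sum_distrib_left)
  also have "\<dots> \<le> (\<Sum>B\<in>G. epowr (ennreal C) p * epowr (?P B) p)"
    by (intro sum_mono B)
  also have "\<dots> \<le> epowr (ennreal C) p * epowr (iprod (\<lambda>i. wnorm (ps i) (w i) (f i))) p"
    using sum_iprod_wnorm_le[OF f finG dyG G(2)]
    by (simp add: sum_distrib_left[symmetric] mult_left_mono)
  finally show ?thesis by (simp add: epowr_mult)
qed

lemma less_dyadic_maximal_iff:
  assumes "f \<in> product_space ps w"
  shows "l < dyadic_maximal f x \<longleftrightarrow> (\<exists>B\<in>dyadic. x \<in> B \<and> l < iprod (\<lambda>i. average (f i) B))"
  using product_spaceD(2)[OF assms] by (auto simp: dyadic_maximal_def less_SUP_iff)

text \<open>Chains of cubes may increase forever, so maximal cubes need not exist.  They do exist in finite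
  subfamilies of the cubes on which the product of averages exceeds \<open>l\<close>, and the general case
  follows by monotone convergence.\<close>

lemma averaging_bound_imp_superlevel_bound:
  assumes avg: "averaging_bound p ps v w C" and f: "f \<in> product_space ps w"
  shows "l * epowr (wmeasure v {x. l < dyadic_maximal f x}) (1 / p)
    \<le> ennreal C * iprod (\<lambda>i. wnorm (ps i) (w i) (f i))"
proof -
  define S where "S = {B \<in> dyadic. l < iprod (\<lambda>i. average (f i) B)}"
  let ?K = "ennreal C * iprod (\<lambda>i. wnorm (ps i) (w i) (f i))"
  define \<mu> where "\<mu> = density lebesgue (\<lambda>x. ennreal (v x))"
  have S: "{x. l < dyadic_maximal f x} = \<Union>S"
    by (auto simp: S_def less_dyadic_maximal_iff[OF f])
  have cS: "countable S"
    by (rule countable_subset[OF _ countable_dyadic]) (auto simp: S_def)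
  have sets: "S \<subseteq> sets lebesgue" using dyadic_sets by (auto simp: S_def)
  have "epowr l p * wmeasure v (\<Union>S) \<le> epowr ?K p"
  proof (cases "S = {}")
    case False
    \<comment> \<open>Unions of the first n cubes of an enumeration; if \<open>S\<close> is finite
      the enumeration has repetitions, which do not affect the unions.\<close>
    define E where "E n = \<Union>(from_nat_into S ` {..<n})" for n :: nat
    have sub: "from_nat_into S ` {..<n} \<subseteq> S" for n
      using from_nat_into[OF False] by auto
    have E_sets: "E n \<in> sets lebesgue" for n
      unfolding E_def using sub sets by (intro sets.finite_Union) blast+
    have "(\<Union>n. E n) = \<Union>(range (from_nat_into S))"
      by (auto simp: E_def)
    also have "\<dots> = \<Union>S" using range_from_nat_into[OF False cS] by simp
    finally have US: "(\<Union>n. E n) = \<Union>S" .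
    have "incseq E" by (force simp: E_def incseq_def)
    then have "emeasure \<mu> (\<Union>S) = (SUP n. emeasure \<mu> (E n))"
      using E_sets unfolding US[symmetric] by (intro SUP_emeasure_incseq[symmetric]) (auto simp: \<mu>_def)
    moreover have "\<Union>S \<in> sets lebesgue"
      using E_sets unfolding US[symmetric] by blast
    ultimately have "wmeasure v (\<Union>S) = (SUP n. wmeasure v (E n))"
      using E_sets by (simp add: wmeasure_eq_emeasure_density \<mu>_def)
    then have "epowr l p * wmeasure v (\<Union>S) = (SUP n. epowr l p * wmeasure v (E n))"
      by (simp add: SUP_mult_left_ennreal)
    also have "\<dots> \<le> epowr ?K p"
    proof (rule SUP_least)
      fix n show "epowr l p * wmeasure v (E n) \<le> epowr ?K p"
        unfolding E_def
        by (rule wmeasure_Union_dyadic_le[OF avg f]) (use sub[of n] in \<open>auto simp: S_def intro: less_imp_le\<close>)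
    qed
    finally show ?thesis .
  qed (simp add: wmeasure_def)
  then have "epowr (l * epowr (wmeasure v (\<Union>S)) (1 / p)) p \<le> epowr ?K p"
    using p_pos by (simp add: epowr_mult epowr_epowr)
  then show ?thesis unfolding S using epowr_le_iff[OF p_pos] by blast
qed

text \<open>The closed superlevel set at l lies in the open one at every \<open>r < l\<close>; then
  r increases to l with the same constant.\<close>

lemma averaging_bound_imp_weak_type_ge_bound:
  assumes "averaging_bound p ps v w C"
  shows "weak_type_ge_bound p ps v w C"
  unfolding weak_type_ge_bound_def
proof (intro ballI allI impI)
  fix f and l :: real assume f: "f \<in> product_space ps w" and "0 < l"
  show "ennreal l * epowr (wmeasure v {x. ennreal l \<le> dyadic_maximal f x}) (1 / p)
      \<le> ennreal C * iprod (\<lambda>i. wnorm (ps i) (w i) (f i))"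
  proof (rule ennreal_mult_le_if_less_le)
    fix r assume r: "ennreal r < ennreal l"
    have "ennreal r * epowr (wmeasure v {x. ennreal l \<le> dyadic_maximal f x}) (1 / p)
        \<le> ennreal r * epowr (wmeasure v {x. ennreal r < dyadic_maximal f x}) (1 / p)"
      using r p_pos by (intro mult_left_mono epowr_mono wmeasure_mono) auto
    also have "\<dots> \<le> ennreal C * iprod (\<lambda>i. wnorm (ps i) (w i) (f i))"
      by (rule averaging_bound_imp_superlevel_bound[OF assms f])
    finally show "ennreal r * epowr (wmeasure v {x. ennreal l \<le> dyadic_maximal f x}) (1 / p)
        \<le> ennreal C * iprod (\<lambda>i. wnorm (ps i) (w i) (f i))" .
  qed
qed

lemma weak_type_ge_bound_imp_weak_type_gt_bound:
  assumes "weak_type_ge_bound p ps v w C"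
  shows "weak_type_gt_bound p ps v w C"
  unfolding weak_type_gt_bound_def
proof (intro ballI allI impI)
  fix f and l :: real assume f: "f \<in> product_space ps w" and l: "0 < l"
  have "ennreal l * epowr (wmeasure v {x. ennreal l < dyadic_maximal f x}) (1 / p)
      \<le> ennreal l * epowr (wmeasure v {x. ennreal l \<le> dyadic_maximal f x}) (1 / p)"
    using p_pos by (intro mult_left_mono epowr_mono wmeasure_mono) auto
  also have "\<dots> \<le> ennreal C * iprod (\<lambda>i. wnorm (ps i) (w i) (f i))"
    using assms f l by (simp add: weak_type_ge_bound_def)
  finally show "ennreal l * epowr (wmeasure v {x. ennreal l < dyadic_maximal f x}) (1 / p)
      \<le> ennreal C * iprod (\<lambda>i. wnorm (ps i) (w i) (f i))" .
qed

text \<open>After truncation to \<open>B\<close> the averages over \<open>B\<close> are unchanged,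
  so all of \<open>B\<close> lies in the superlevel set of every l below their product; then l
  increases to that product.\<close>

lemma weak_type_gt_bound_imp_averaging_bound:
  assumes "weak_type_gt_bound p ps v w C"
  shows "averaging_bound p ps v w C"
  unfolding averaging_bound_def
proof (intro ballI)
  fix f B assume f: "f \<in> product_space ps w" and B: "B \<in> (dyadic :: (real ^ 'n) set set)"
  define g where "g i x = f i x * indicator B x" for i x
  have g: "g \<in> product_space ps w"
    using product_space_indicator[OF f dyadic_sets(2)[OF B]] by (simp add: g_def[abs_def])
  have avg: "average (g i) B = average (f i) B" for i
    unfolding average_def g_def
    by (intro arg_cong2[where f = "(/)"] nn_integral_cong) (auto split: split_indicator)
  have "iprod (\<lambda>i. average (f i) B) * epowr (wmeasure v B) (1 / p)
      \<le> ennreal C * iprod (\<lambda>i. wnorm (ps i) (w i) (g i))"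
  proof (rule ennreal_mult_le_if_less_le)
    fix l :: real assume l: "0 < l" "ennreal l < iprod (\<lambda>i. average (f i) B)"
    have "B \<subseteq> {x. ennreal l < dyadic_maximal g x}"
      using l(2) B by (auto simp: less_dyadic_maximal_iff[OF g] avg)
    then have "ennreal l * epowr (wmeasure v B) (1 / p)
        \<le> ennreal l * epowr (wmeasure v {x. ennreal l < dyadic_maximal g x}) (1 / p)"
      using p_pos by (intro mult_left_mono epowr_mono wmeasure_mono) auto
    also have "\<dots> \<le> ennreal C * iprod (\<lambda>i. wnorm (ps i) (w i) (g i))"
      using assms g l(1) by (simp add: weak_type_gt_bound_def)
    finally show "ennreal l * epowr (wmeasure v B) (1 / p)
        \<le> ennreal C * iprod (\<lambda>i. wnorm (ps i) (w i) (g i))" .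
  qed
  then show "epowr (wmeasure v B) (1 / p) * iprod (\<lambda>i. average (f i) B)
      \<le> ennreal C * iprod (\<lambda>i. wnorm (ps i) (w i) (\<lambda>x. f i x * indicator B x))"
    by (simp add: g_def[abs_def] mult.commute)
qed

text \<open>Every implication keeps \<open>C\<close>, so the bounds agree as predicates of the
  constant; this yields the equivalences and the equality of smallest constants at once.\<close>

lemma bounds_eq:
  "averaging_bound p ps v w = Ap_bound p ps v w"
  "weak_type_ge_bound p ps v w = Ap_bound p ps v w"
  "weak_type_gt_bound p ps v w = Ap_bound p ps v w"
  using Ap_bound_imp_averaging_bound averaging_bound_imp_Ap_bound averaging_bound_imp_weak_type_ge_bound
    weak_type_ge_bound_imp_weak_type_gt_bound weak_type_gt_bound_imp_averaging_bound
  by (intro ext; blast)+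

end

text \<open>For each cube the left-hand side is a lower bound of all admissible constants, hence at
  most their infimum, which is finite because one such constant exists.\<close>

lemma smallest_const_Ap_bound_attained:
  assumes "0 < C" "Ap_bound p ps v w C"
  shows "\<exists>K\<ge>0. smallest_const (Ap_bound p ps v w) = ennreal K \<and> Ap_bound p ps v w K"
proof -
  define s where "s = smallest_const (Ap_bound p ps v w)"
  have "s \<le> ennreal C"
    using assms unfolding s_def smallest_const_def by (intro Inf_lower) auto
  then have s: "s = ennreal (enn2real s)"
    by (metis ennreal_enn2real ennreal_less_top le_less_trans)
  have "Ap_bound p ps v w (enn2real s)"
    unfolding Ap_bound_def s[symmetric] unfolding s_def smallest_const_def
    by (intro ballI Inf_greatest) (auto simp: Ap_bound_def)
  then show ?thesis using s by (intro exI[of _ "enn2real s"]) (simp add: s_def)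
qed

theorem theorem3p2:
  fixes p :: real and ps :: "nat \<Rightarrow> real"
    and v :: "real ^ 'n \<Rightarrow> real" and w :: "nat \<Rightarrow> real ^ 'n \<Rightarrow> real"
  assumes "\<And>i. 1 < ps i"
    and "(\<lambda>i. 1 / ps i) sums (1 / p)"
    and "weight v"
    and "\<And>i. weight (w i)"
    and "standing_assumptions ps w"
  shows "((\<exists>C>0. Ap_bound p ps v w C) \<longleftrightarrow> (\<exists>C>0. averaging_bound p ps v w C)) \<and>
         ((\<exists>C>0. averaging_bound p ps v w C) \<longleftrightarrow> (\<exists>C>0. weak_type_ge_bound p ps v w C)) \<and>
         ((\<exists>C>0. weak_type_ge_bound p ps v w C) \<longleftrightarrow> (\<exists>C>0. weak_type_gt_bound p ps v w C)) \<and>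
         smallest_const (Ap_bound p ps v w) = smallest_const (averaging_bound p ps v w) \<and>
         smallest_const (averaging_bound p ps v w) = smallest_const (weak_type_ge_bound p ps v w) \<and>
         smallest_const (weak_type_ge_bound p ps v w) = smallest_const (weak_type_gt_bound p ps v w) \<and>
         ((\<exists>C>0. Ap_bound p ps v w C) \<longrightarrow>
            (\<exists>K\<ge>0. smallest_const (Ap_bound p ps v w) = ennreal K \<and>
               Ap_bound p ps v w K \<and> averaging_bound p ps v w K \<and>
               weak_type_ge_bound p ps v w K \<and> weak_type_gt_bound p ps v w K))"
proof -
  interpret infinite_weights p ps v w
    using assms by unfold_locales
  show ?thesis
    unfolding bounds_eq using smallest_const_Ap_bound_attained by blast
qed

end
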